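(* Let $p\in[0,1]$ and $q=1-p$. In the tennis game system, where the server has probability $p$ of winning each point, the mean $\mu_G(p)$ and variance $\sigma_G^2(p)$ of the number of points $N_G$ played in the game are $$\mu_G(p)=\sum_{n=4}^6 n\binom{n-1}{3}\left[p^4q^{n-4}+q^4p^{n-4}\right]+\left[6+\frac{2}{p^2+q^2}\right]\binom{6}{3}p^3q^3,$$ $$\sigma_G^2(p)=\left[\left\{\sum_{n=4}^6 n^2\binom{n-1}{3}\left[p^4q^{n-4}+q^4p^{n-4}\right]+\left[6+\frac{2}{p^2+q^2}\right]^2\binom{6}{3}p^3q^3\right\}-\mu_G^2(p)\right]+4\left[\frac{1-(p^2+q^2)}{(p^2+q^2)^2}\right]\binom{6}{3}p^3q^3,$$ where $\mu_G^2(p)=(\mu_G(p))^2$. Also, $\mu_G(p)=\mu_G(q)$ and $\sigma_G^2(p)=\sigma_G^2(q)$.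
   Context: Tennis game: one player (the server) serves all points. Point outcomes are independent, and the server wins each point with probability $p$ (otherwise the receiver wins it). The game ends, and is won by a player, as soon as that player has won at least 4 points and is ahead by at least 2 points (so if the score reaches 3 points each, play continues until one player is ahead by two points). $N_G$ is the total number of points played when the game ends. Convention: $0^0=1$. *)

theory Defs
  imports "HOL-Probability.Probability"
begin

text \<open>An outcome is a sequence \<open>\<omega>\<close>, where \<open>\<omega> i\<close> says that the server wins the point played
  after \<open>i\<close> points (so the first point has index 0). For convenience the sequence goes on
  after the end of the game.\<close>

definition point_space :: "real \<Rightarrow> (nat \<Rightarrow> bool) measure" where
  "point_space p = PiM UNIV (\<lambda>_. measure_pmf (bernoulli_pmf p))"

definition server_points :: "(nat \<Rightarrow> bool) \<Rightarrow> nat \<Rightarrow> nat" where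
  "server_points \<omega> n = card {i. i < n \<and> \<omega> i}"

definition receiver_points :: "(nat \<Rightarrow> bool) \<Rightarrow> nat \<Rightarrow> nat" where
  "receiver_points \<omega> n = card {i. i < n \<and> \<not> \<omega> i}"

definition wins_game :: "nat \<Rightarrow> nat \<Rightarrow> bool" where
  "wins_game own opp \<longleftrightarrow> own \<ge> 4 \<and> own \<ge> opp + 2"

definition game_over :: "(nat \<Rightarrow> bool) \<Rightarrow> nat \<Rightarrow> bool" where
  "game_over \<omega> n \<longleftrightarrow>
     wins_game (server_points \<omega> n) (receiver_points \<omega> n) \<or>
     wins_game (receiver_points \<omega> n) (server_points \<omega> n)"

text \<open>If the game never ends, the value of \<open>N_G\<close> is meaningless; this event has
  probability 0 for every \<open>p\<close> in the unit interval.\<close>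

definition N_G :: "(nat \<Rightarrow> bool) \<Rightarrow> nat" where
  "N_G \<omega> = (LEAST n. game_over \<omega> n)"

definition mu_G :: "real \<Rightarrow> real" where
  "mu_G p = prob_space.expectation (point_space p) (\<lambda>\<omega>. real (N_G \<omega>))"

definition sigma2_G :: "real \<Rightarrow> real" where
  "sigma2_G p = prob_space.variance (point_space p) (\<lambda>\<omega>. real (N_G \<omega>))"

end

theory Submission
  imports Defs
begin

text \<open>
  The law of \<open>N_G\<close> is explicit. A player wins after exactly \<open>n\<close> points with \<open>4 \<le> n \<le> 6\<close> by winning
  the last point and exactly three of the \<open>n - 1\<close> before it. All other games pass through the score
  3-3 after six points, which has probability \<open>20 p\<^sup>3 q\<^sup>3\<close>. From there play proceeds in rounds of two
  points: with probability \<open>s = p\<^sup>2 + q\<^sup>2\<close> one player takes both points and the game ends; with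
  probability \<open>2 p q = 1 - s\<close> the score is tied again. So in that case \<open>N_G = 6 + 2 K\<close>, where
  \<open>K \<ge> 1\<close> is geometric with success probability \<open>s\<close>, and the terms \<open>6 + 2 / s\<close> and
  \<open>4 (1 - s) / s\<^sup>2\<close> of the theorem are the mean and the variance of \<open>6 + 2 K\<close>.

  The event that the game, continued from a score \<open>(a, b)\<close>, first ends after \<open>n\<close> more points is
  \<open>ends_at\<close>. Conditioning on the first point (\<open>prob_first_point\<close>) gives its probability by recursion
  on \<open>n\<close>, for all scores at once (\<open>prob_ends_at\<close>), and the recursion is solved from a tied score and
  from 0-0. The resulting series, weighted by 1, \<open>n\<close> and \<open>n\<^sup>2\<close>, is summed by the single lemma
  \<open>sums_end_prob\<close> together with power series in \<open>2 p q\<close>. The weight 1 shows that the total mass is 1,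
  so the game ends almost surely and the value of \<open>N_G\<close> on endless games does not affect its law; the
  other two weights give the first two moments. The symmetry in \<open>p\<close> and \<open>q\<close> is then visible in the
  formulas.
\<close>

section \<open>Ending times from an arbitrary score\<close>

definition finished :: "nat \<Rightarrow> nat \<Rightarrow> bool" where
  "finished a b \<longleftrightarrow> wins_game a b \<or> wins_game b a"

text \<open>The starting score \<open>(a, b)\<close> is a parameter because conditioning on the first point moves
  it. This event refers to no \<open>LEAST\<close>, so its recursion holds for every outcome, including those on
  which the game never ends.\<close>
definition ends_at :: "nat \<Rightarrow> nat \<Rightarrow> nat \<Rightarrow> (nat \<Rightarrow> bool) \<Rightarrow> bool" where
  "ends_at n a b \<omega> \<longleftrightarrow>
     finished (a + server_points \<omega> n) (b + receiver_points \<omega> n) \<and>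
     (\<forall>m<n. \<not> finished (a + server_points \<omega> m) (b + receiver_points \<omega> m))"

lemma game_over_iff_finished:
  "game_over \<omega> n \<longleftrightarrow> finished (server_points \<omega> n) (receiver_points \<omega> n)"
  by (simp add: game_over_def finished_def)

lemma ends_at_imp_N_G:
  assumes "ends_at n 0 0 \<omega>"
  shows "N_G \<omega> = n"
  unfolding N_G_def
proof (rule Least_equality)
  show "game_over \<omega> n"
    using assms by (simp add: ends_at_def game_over_iff_finished)
  show "n \<le> m" if "game_over \<omega> m" for m
    using assms that by (auto simp: ends_at_def game_over_iff_finished not_less[symmetric])
qed

lemma card_case_nat_less_Suc:
  "card {i. i < Suc n \<and> P (case_nat x \<omega> i)} = of_bool (P x) + card {i. i < n \<and> P (\<omega> i)}"
proof -
  have "{i. i < Suc n \<and> P (case_nat x \<omega> i)} =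
      (if P x then {0} else {}) \<union> Suc ` {i. i < n \<and> P (\<omega> i)}"
    by (auto simp: image_iff less_Suc_eq_0_disj)
  moreover have "card ((if P x then {0} else {}) \<union> Suc ` {i. i < n \<and> P (\<omega> i)}) =
      of_bool (P x) + card (Suc ` {i. i < n \<and> P (\<omega> i)})"
    by (subst card_Un_disjoint) auto
  ultimately show ?thesis
    by (simp add: card_image)
qed

lemma server_points_case_nat:
  "server_points (case_nat x \<omega>) (Suc n) = of_bool x + server_points \<omega> n"
  unfolding server_points_def using card_case_nat_less_Suc[of n "\<lambda>y. y" x \<omega>] by simp

lemma receiver_points_case_nat:
  "receiver_points (case_nat x \<omega>) (Suc n) = of_bool (\<not> x) + receiver_points \<omega> n"
  unfolding receiver_points_def using card_case_nat_less_Suc[of n Not x \<omega>] by simp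

lemma points_0 [simp]: "server_points \<omega> 0 = 0" "receiver_points \<omega> 0 = 0"
  by (simp_all add: server_points_def receiver_points_def)

lemma ends_at_0: "ends_at 0 a b \<omega> \<longleftrightarrow> finished a b"
  by (simp add: ends_at_def)

lemma ends_at_case_nat:
  "ends_at (Suc n) a b (case_nat x \<omega>) \<longleftrightarrow>
     \<not> finished a b \<and> ends_at n (a + of_bool x) (b + of_bool (\<not> x)) \<omega>"
  by (auto simp: ends_at_def server_points_case_nat receiver_points_case_nat All_less_Suc2
      add.assoc simp del: of_bool_not_iff)

section \<open>Measurability\<close>
lemma prob_space_point_space: "prob_space (point_space p)"
  unfolding point_space_def by (intro prob_space_PiM prob_space_measure_pmf)

lemma space_point_space [simp]: "space (point_space p) = UNIV"
  by (simp add: point_space_def space_PiM PiE_UNIV_domain)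

lemma measurable_point [measurable]:
  "(\<lambda>\<omega>. \<omega> i) \<in> measurable (point_space p) (count_space UNIV)"
  unfolding point_space_def by measurable

lemma measurable_server_points [measurable]:
  "(\<lambda>\<omega>. server_points \<omega> n) \<in> measurable (point_space p) (count_space UNIV)"
proof -
  have "server_points \<omega> n = (\<Sum>i<n. of_bool (\<omega> i))" for \<omega>
    unfolding server_points_def by (simp add: of_bool_def sum.If_cases Int_def)
  then show ?thesis by simp
qed

lemma measurable_receiver_points [measurable]:
  "(\<lambda>\<omega>. receiver_points \<omega> n) \<in> measurable (point_space p) (count_space UNIV)"
proof -
  have "receiver_points \<omega> n = (\<Sum>i<n. of_bool (\<not> \<omega> i))" for \<omega>
    unfolding receiver_points_def by (simp add: of_bool_def sum.If_cases Int_def)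
  then show ?thesis by simp
qed

lemma measurable_ends_at [measurable]: "Measurable.pred (point_space p) (ends_at n a b)"
  unfolding ends_at_def[abs_def] by measurable

lemma measurable_N_G [measurable]: "N_G \<in> measurable (point_space p) (count_space UNIV)"
  unfolding N_G_def[abs_def] game_over_iff_finished by measurable

section \<open>The law of the ending time\<close>

text \<open>A Bernoulli sequence is an independent first bit followed by a sequence of the same law.\<close>
lemma prob_first_point:
  assumes p: "0 \<le> p" "p \<le> 1" and P [measurable]: "Measurable.pred (point_space p) P"
  shows "\<P>(\<omega> in point_space p. P \<omega>) =
    p * \<P>(\<omega> in point_space p. P (case_nat True \<omega>)) +
    (1 - p) * \<P>(\<omega> in point_space p. P (case_nat False \<omega>))"
proof -
  interpret ps: prob_space "point_space p" by (rule prob_space_point_space)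
  have events: "{\<omega>. P \<omega>} \<in> sets (point_space p)"
    using P by (simp only: pred_def space_point_space) simp
  let ?B = "measure_pmf (bernoulli_pmf p)"
  let ?f = "\<lambda>(x, \<omega>). case_nat x \<omega>"
  interpret sequence_space ?B by unfold_locales
  have f [measurable]: "?f \<in> ?B \<Otimes>\<^sub>M point_space p \<rightarrow>\<^sub>M point_space p"
    unfolding point_space_def by measurable
  have iter: "distr (?B \<Otimes>\<^sub>M point_space p) (point_space p) ?f = point_space p"
    using PiM_iter unfolding point_space_def .
  have preimage: "{y. P (?f y)} \<in> sets (?B \<Otimes>\<^sub>M point_space p)"
    using measurable_sets[OF f events] by (simp add: vimage_def space_pair_measure)
  have cons [measurable]: "case_nat x \<in> point_space p \<rightarrow>\<^sub>M point_space p" for x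
    using measurable_compose[OF measurable_Pair1' f, of x] by simp
  have "emeasure (point_space p) {\<omega>. P \<omega>} =
      emeasure (distr (?B \<Otimes>\<^sub>M point_space p) (point_space p) ?f) {\<omega>. P \<omega>}"
    by (simp only: iter)
  also have "\<dots> = emeasure (?B \<Otimes>\<^sub>M point_space p) {y. P (?f y)}"
    by (subst emeasure_distr) (simp_all add: events space_pair_measure vimage_def)
  also have "\<dots> = (\<integral>\<^sup>+x. emeasure (point_space p) {\<omega>. P (case_nat x \<omega>)} \<partial>?B)"
    by (subst ps.emeasure_pair_measure_alt) (simp_all add: preimage vimage_def)
  also have "\<dots> = emeasure (point_space p) {\<omega>. P (case_nat True \<omega>)} * p +
      emeasure (point_space p) {\<omega>. P (case_nat False \<omega>)} * (1 - p)"
    using p by simp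
  finally show ?thesis
    using p by (simp add: ps.emeasure_eq_measure ennreal_mult[symmetric] ennreal_plus[symmetric]
        mult.commute del: ennreal_plus)
qed

primrec end_prob :: "real \<Rightarrow> nat \<Rightarrow> nat \<Rightarrow> nat \<Rightarrow> real" where
  "end_prob p 0 a b = of_bool (finished a b)"
| "end_prob p (Suc n) a b = (if finished a b then 0
     else p * end_prob p n (Suc a) b + (1 - p) * end_prob p n a (Suc b))"

text \<open>The score in the induction is arbitrary: after the first point, the hypothesis is used at
  \<open>(a + 1, b)\<close> and at \<open>(a, b + 1)\<close>.\<close>
lemma prob_ends_at:
  assumes p: "0 \<le> p" "p \<le> 1"
  shows "\<P>(\<omega> in point_space p. ends_at n a b \<omega>) = end_prob p n a b"
proof (induction n arbitrary: a b)
  case 0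
  interpret prob_space "point_space p" by (rule prob_space_point_space)
  show ?case
    using prob_space by (cases "finished a b") (simp_all add: ends_at_0)
next
  case (Suc n)
  then show ?case
    by (subst prob_first_point[OF p]) (simp_all add: ends_at_case_nat)
qed

text \<open>From a tied score with at least three points each, only a lead of two ends the game, and the
  lead has the parity of the number of points played. If the first two points are shared, the score
  is tied again one level higher, so both inductions vary \<open>k\<close>.\<close>
lemma end_prob_deuce_odd:
  "end_prob p (Suc (2 * j)) (3 + k) (3 + k) = 0"
proof (induction j arbitrary: k)
  case (Suc j)
  then show ?case
    using Suc.IH[of "Suc k"] by (simp add: finished_def wins_game_def)
qed (simp add: finished_def wins_game_def)

lemma end_prob_deuce_even:
  "end_prob p (Suc (Suc (2 * j))) (3 + k) (3 + k) =
     (p\<^sup>2 + (1 - p)\<^sup>2) * (2 * p * (1 - p)) ^ j"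
proof (induction j arbitrary: k)
  case (Suc j)
  then show ?case
    using Suc.IH[of "Suc k"] by (simp add: finished_def wins_game_def)
qed (simp add: finished_def wins_game_def power2_eq_square)

lemma end_prob_before_4:
  assumes "n < 4"
  shows "end_prob p n 0 0 = 0"
proof -
  have "n = 0 \<or> n = Suc 0 \<or> n = Suc (Suc 0) \<or> n = Suc (Suc (Suc 0))"
    using assms by auto
  then show ?thesis
    by (auto simp: finished_def wins_game_def)
qed

text \<open>The winner takes the last point and any three of the \<open>n - 1\<close> earlier ones; with \<open>n \<le> 6\<close>
  the loser has at most two points, so the required lead is automatic.\<close>
lemma end_prob_4_to_6:
  assumes "4 \<le> n" "n \<le> 6"
  shows "end_prob p n 0 0 =
     real ((n - 1) choose 3) * (p ^ 4 * (1 - p) ^ (n - 4) + (1 - p) ^ 4 * p ^ (n - 4))"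
proof -
  have "n = 4 \<or> n = 5 \<or> n = 6" using assms by auto
  then show ?thesis
    by (auto simp: eval_nat_numeral finished_def wins_game_def) (simp_all add: algebra_simps)
qed

text \<open>After six points, every score other than 3-3 has been decided by then.\<close>
lemma end_prob_after_6:
  "end_prob p (6 + Suc m) 0 0 =
     real (6 choose 3) * p ^ 3 * (1 - p) ^ 3 * end_prob p (Suc m) 3 3"
  by (simp add: eval_nat_numeral finished_def wins_game_def)

text \<open>This reduces every series \<open>\<Sum>n. g n * P(N_G = n)\<close> to a power series in \<open>2 p q\<close>: beyond
  \<open>n = 6\<close> only the times \<open>n = 8 + 2 j\<close> contribute, the \<open>j\<close>-th after \<open>j\<close> shared rounds and one
  decisive round.\<close>
lemma sums_end_prob:
  fixes g :: "nat \<Rightarrow> real"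
  assumes G: "(\<lambda>j. g (8 + 2 * j) * (2 * p * (1 - p)) ^ j) sums G"
  shows "(\<lambda>n. g n * end_prob p n 0 0) sums
    ((\<Sum>n=4..6. g n * real ((n - 1) choose 3) *
        (p ^ 4 * (1 - p) ^ (n - 4) + (1 - p) ^ 4 * p ^ (n - 4)))
     + real (6 choose 3) * p ^ 3 * (1 - p) ^ 3 * ((p\<^sup>2 + (1 - p)\<^sup>2) * G))"
    (is "?f sums (?A + ?c * (?s * G))")
proof -
  (* The tail starts at 7, so its odd positions are the times 8, 10, 12, ... *)
  have odd: "?f (2 * j + 7) = 0" for j
    using end_prob_after_6[of p "2 * j"] end_prob_deuce_odd[of p j 0] by (simp add: add.commute)
  have even: "?f (Suc (2 * j) + 7) = ?c * ?s * (g (8 + 2 * j) * (2 * p * (1 - p)) ^ j)" for j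
    using end_prob_after_6[of p "Suc (2 * j)"] end_prob_deuce_even[of p j 0]
    by (simp add: add.commute)
  have "(\<lambda>j. ?f (Suc (2 * j) + 7)) sums (?c * ?s * G)"
    unfolding even by (rule sums_mult[OF G])
  moreover have "?f (n + 7) = 0" if "n \<notin> range (\<lambda>j. Suc (2 * j))" for n
    using that odd by (cases "even n") (auto elim!: evenE oddE)
  ultimately have "(\<lambda>n. ?f (n + 7)) sums (?c * ?s * G)"
    by (subst (asm) sums_mono_reindex[of "\<lambda>j. Suc (2 * j)" "\<lambda>n. ?f (n + 7)"])
       (auto simp: strict_mono_def)
  then have "?f sums (?c * ?s * G + (\<Sum>n<7. ?f n))"
    by (rule sums_iff_shift[THEN iffD1])
  also have "(\<Sum>n<7. ?f n) = (\<Sum>n=4..6. ?f n)"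
    by (rule sum.mono_neutral_right) (auto simp: end_prob_before_4)
  also have "\<dots> = ?A"
    by (intro sum.cong) (auto simp: end_prob_4_to_6 mult.assoc)
  finally show ?thesis
    by (simp only: add.commute mult.assoc)
qed

section \<open>Total mass and expectations\<close>

text \<open>The second derivative of the geometric series, needed for the second moment.\<close>
lemma sums_Suc_Suc_power:
  fixes z :: "'a :: {real_normed_field, banach}"
  assumes "norm z < 1"
  shows "(\<lambda>n. of_nat (Suc n) * of_nat (Suc (Suc n)) * z ^ n) sums (2 / (1 - z) ^ 3)"
proof -
  have "(\<lambda>n. diffs (\<lambda>n. of_nat (Suc n)) n * z ^ n) sums (2 / (1 - z) ^ 3)"
  proof (rule termdiffs_sums_strong)
    show "(\<lambda>n. of_nat (Suc n) * w ^ n) sums (1 / (1 - w)\<^sup>2)" if "norm w < 1" for w :: 'a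
      using that by (rule geometric_deriv_sums)
    have "1 - z \<noteq> 0" using assms by auto
    then show "((\<lambda>w. 1 / (1 - w)\<^sup>2) has_field_derivative 2 / (1 - z) ^ 3) (at z)"
      by (auto intro!: derivative_eq_intros simp: divide_simps)
        (simp_all add: eval_nat_numeral)
  qed (use assms in auto)
  then show ?thesis
    unfolding diffs_def by (simp only: of_nat_mult)
qed

text \<open>A two-point round from a tie is either shared or decisive, and decisive rounds have positive
  probability even for \<open>p = 0\<close> or \<open>p = 1\<close>. This makes all the power series converge.\<close>
lemma deuce_repeat_prob:
  fixes p :: real
  assumes "0 \<le> p" "p \<le> 1"
  shows "norm (2 * p * (1 - p)) < 1" "1 - 2 * p * (1 - p) = p\<^sup>2 + (1 - p)\<^sup>2"
proof -
  show eq: "1 - 2 * p * (1 - p) = p\<^sup>2 + (1 - p)\<^sup>2"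
    by (simp add: power2_eq_square algebra_simps)
  have "0 < p\<^sup>2 + (1 - p)\<^sup>2"
    by (cases "p = 0") (auto intro: add_pos_nonneg)
  moreover have "0 \<le> 2 * p * (1 - p)"
    using assms by simp
  ultimately show "norm (2 * p * (1 - p)) < 1"
    using eq unfolding real_norm_def by linarith
qed

text \<open>The geometric part sums to 1, and what remains is a polynomial identity in \<open>p\<close>.\<close>
lemma end_prob_sums_1:
  assumes p: "0 \<le> p" "p \<le> 1"
  shows "(\<lambda>n. end_prob p n 0 0) sums 1"
proof -
  let ?s = "p\<^sup>2 + (1 - p)\<^sup>2"
  note repeat = deuce_repeat_prob[OF p]
  have "(\<lambda>j. 1 * (2 * p * (1 - p)) ^ j) sums (1 / ?s)"
    using geometric_sums[OF repeat(1)] unfolding repeat(2) by simp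
  note sums_end_prob[OF this]
  also have "?s * (1 / ?s) = 1"
    using repeat by simp
  also have "(\<Sum>n=4..6. 1 * real ((n - 1) choose 3) *
        (p ^ 4 * (1 - p) ^ (n - 4) + (1 - p) ^ 4 * p ^ (n - 4)))
      + real (6 choose 3) * p ^ 3 * (1 - p) ^ 3 * 1 = 1"
    by (simp add: eval_nat_numeral) algebra
  finally show ?thesis by simp
qed

text \<open>The events for different \<open>n\<close> are disjoint, since each determines \<open>N_G\<close>, so the probability
  of their union is the total mass.\<close>
lemma AE_game_ends:
  assumes p: "0 \<le> p" "p \<le> 1"
  shows "AE \<omega> in point_space p. \<exists>n. ends_at n 0 0 \<omega>"
proof -
  interpret prob_space "point_space p" by (rule prob_space_point_space)
  let ?E = "\<lambda>n. {\<omega>. ends_at n 0 0 \<omega>}"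
  have E: "?E n \<in> events" for n
    using measurable_ends_at by (simp add: pred_def)
  have "disjoint_family ?E"
    by (auto simp: disjoint_family_on_def dest: ends_at_imp_N_G)
  then have "(\<lambda>n. prob (?E n)) sums prob (\<Union>n. ?E n)"
    using E by (intro finite_measure_UNION) auto
  moreover have "prob (?E n) = end_prob p n 0 0" for n
    using prob_ends_at[OF p, of n 0 0] by simp
  ultimately have "prob (\<Union>n. ?E n) = 1"
    using end_prob_sums_1[OF p] sums_unique2 by force
  then have "AE \<omega> in point_space p. \<omega> \<in> (\<Union>n. ?E n)"
    using E by (subst (asm) prob_eq_1) auto
  then show ?thesis by simp
qed

lemma distr_N_G:
  assumes p: "0 \<le> p" "p \<le> 1"
  shows "distr (point_space p) (count_space UNIV) N_G =
    density (count_space UNIV) (\<lambda>n. end_prob p n 0 0)"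
proof (rule measure_eqI_countable[where A = UNIV])
  fix n
  interpret prob_space "point_space p" by (rule prob_space_point_space)
  have "AE \<omega> in point_space p. N_G \<omega> = n \<longleftrightarrow> ends_at n 0 0 \<omega>"
    using AE_game_ends[OF assms] by eventually_elim (auto dest: ends_at_imp_N_G)
  then have "emeasure (point_space p) {\<omega>\<in>space (point_space p). N_G \<omega> = n} =
      emeasure (point_space p) {\<omega>\<in>space (point_space p). ends_at n 0 0 \<omega>}"
    by (intro emeasure_eq_AE) (simp, measurable)
  also have "\<dots> = end_prob p n 0 0"
    unfolding emeasure_eq_measure prob_ends_at[OF p] ..
  finally show "emeasure (distr (point_space p) (count_space UNIV) N_G) {n} =
      emeasure (density (count_space UNIV) (\<lambda>n. end_prob p n 0 0)) {n}"
    by (simp add: emeasure_distr emeasure_density vimage_def nn_integral_count_space_indicator[symmetric])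
qed auto

lemma has_bochner_integral_N_G:
  fixes g :: "nat \<Rightarrow> real"
  assumes p: "0 \<le> p" "p \<le> 1"
    and g: "\<And>n. 0 \<le> g n" and m: "(\<lambda>n. g n * end_prob p n 0 0) sums m"
  shows "has_bochner_integral (point_space p) (\<lambda>\<omega>. g (N_G \<omega>)) m"
proof -
  have nonneg: "0 \<le> end_prob p n 0 0" for n
    using measure_nonneg prob_ends_at[OF p, of n 0 0] by metis
  have int: "integrable (count_space UNIV) (\<lambda>n. g n * end_prob p n 0 0)"
    using m g nonneg by (simp add: integrable_count_space_nat_iff sums_iff)
  then have "has_bochner_integral (count_space UNIV) (\<lambda>n. g n * end_prob p n 0 0) m"
    using m by (simp add: has_bochner_integral_iff integral_count_space_nat sums_iff)
  then have "has_bochner_integral (distr (point_space p) (count_space UNIV) N_G) g m"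
    unfolding distr_N_G[OF p] using nonneg
    by (intro has_bochner_integral_density) (simp_all add: mult.commute)
  then show ?thesis
    by (simp add: has_bochner_integral_iff integrable_distr_eq integral_distr)
qed

section \<open>Mean and variance\<close>

lemma N_G_moments:
  fixes p q :: real
  assumes "0 \<le> p" and "p \<le> 1" and q: "q = 1 - p"
  shows "AE \<omega> in point_space p. \<exists>n. game_over \<omega> n" (is ?AE)
    and "has_bochner_integral (point_space p) (\<lambda>\<omega>. real (N_G \<omega>))
           ((\<Sum>n=4..6. real n * real ((n - 1) choose 3) * (p ^ 4 * q ^ (n - 4) + q ^ 4 * p ^ (n - 4)))
           + (6 + 2 / (p\<^sup>2 + q\<^sup>2)) * real (6 choose 3) * p ^ 3 * q ^ 3)" (is ?mean)
    and "has_bochner_integral (point_space p) (\<lambda>\<omega>. (real (N_G \<omega>))\<^sup>2)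
           ((\<Sum>n=4..6. (real n)\<^sup>2 * real ((n - 1) choose 3) *
                (p ^ 4 * q ^ (n - 4) + q ^ 4 * p ^ (n - 4)))
             + (6 + 2 / (p\<^sup>2 + q\<^sup>2))\<^sup>2 * real (6 choose 3) * p ^ 3 * q ^ 3
             + 4 * ((1 - (p\<^sup>2 + q\<^sup>2)) / (p\<^sup>2 + q\<^sup>2)\<^sup>2) * real (6 choose 3) * p ^ 3 * q ^ 3)"
       (is ?square)
proof -
  note p = \<open>0 \<le> p\<close> \<open>p \<le> 1\<close>
  define s r where "s = p\<^sup>2 + q\<^sup>2" and r: "r = 2 * p * (1 - p)"
  have norm: "norm r < 1" and r_eq: "1 - r = s"
    using deuce_repeat_prob[OF p] by (simp_all add: r s_def q)
  then have "0 < s" by simp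
  have S0: "(\<lambda>j. r ^ j) sums (1 / s)"
    using geometric_sums[OF norm] unfolding r_eq .
  have S1: "(\<lambda>j. real (Suc j) * r ^ j) sums (1 / s\<^sup>2)"
    using geometric_deriv_sums[OF norm] unfolding r_eq .
  have S2: "(\<lambda>j. real (Suc j) * real (Suc (Suc j)) * r ^ j) sums (2 / s ^ 3)"
    using sums_Suc_Suc_power[OF norm] unfolding r_eq .
  (* Expand the weights in the basis 1, j + 1, (j + 1) (j + 2), whose series are known:
     8 + 2 j = 6 + 2 (j + 1) and (8 + 2 j)^2 = 36 + 20 (j + 1) + 4 (j + 1) (j + 2). *)
  have G1: "(\<lambda>j. real (8 + 2 * j) * (2 * p * (1 - p)) ^ j) sums (6 * (1 / s) + 2 * (1 / s\<^sup>2))"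
    using sums_add[OF sums_mult[OF S0, of 6] sums_mult[OF S1, of 2]]
    by (simp add: r algebra_simps)
  have G2: "(\<lambda>j. (real (8 + 2 * j))\<^sup>2 * (2 * p * (1 - p)) ^ j) sums
      (36 * (1 / s) + 20 * (1 / s\<^sup>2) + 4 * (2 / s ^ 3))"
    using sums_add[OF sums_add[OF sums_mult[OF S0, of 36] sums_mult[OF S1, of 20]] sums_mult[OF S2, of 4]]
    by (simp add: r algebra_simps power2_eq_square)
  show ?AE
    using AE_game_ends[OF p]
    by eventually_elim (auto simp: ends_at_def game_over_iff_finished)
  have eq1: "s * (6 * (1 / s) + 2 * (1 / s\<^sup>2)) = 6 + 2 / s"
    using \<open>0 < s\<close> by (simp add: field_simps power2_eq_square)
  have "(\<lambda>n. real n * end_prob p n 0 0) sums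
      ((\<Sum>n=4..6. real n * real ((n - 1) choose 3) * (p ^ 4 * q ^ (n - 4) + q ^ 4 * p ^ (n - 4)))
       + real (6 choose 3) * p ^ 3 * q ^ 3 * (s * (6 * (1 / s) + 2 * (1 / s\<^sup>2))))"
    using sums_end_prob[OF G1] unfolding s_def q .
  then have "has_bochner_integral (point_space p) (\<lambda>\<omega>. real (N_G \<omega>))
      ((\<Sum>n=4..6. real n * real ((n - 1) choose 3) * (p ^ 4 * q ^ (n - 4) + q ^ 4 * p ^ (n - 4)))
       + real (6 choose 3) * p ^ 3 * q ^ 3 * (6 + 2 / s))"
    unfolding eq1 by (intro has_bochner_integral_N_G[OF p]) simp_all
  then show ?mean
    unfolding s_def[symmetric] by (simp only: mult.commute mult.left_commute)
  (* The second moment of 6 + 2 K, written as squared mean plus variance. *)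
  have eq2: "s * (36 * (1 / s) + 20 * (1 / s\<^sup>2) + 4 * (2 / s ^ 3)) =
      (6 + 2 / s)\<^sup>2 + 4 * ((1 - s) / s\<^sup>2)"
    using \<open>0 < s\<close> by (simp add: field_simps eval_nat_numeral)
  have "(\<lambda>n. (real n)\<^sup>2 * end_prob p n 0 0) sums
      ((\<Sum>n=4..6. (real n)\<^sup>2 * real ((n - 1) choose 3) * (p ^ 4 * q ^ (n - 4) + q ^ 4 * p ^ (n - 4)))
       + real (6 choose 3) * p ^ 3 * q ^ 3 *
         (s * (36 * (1 / s) + 20 * (1 / s\<^sup>2) + 4 * (2 / s ^ 3))))"
    using sums_end_prob[OF G2] unfolding s_def q .
  then have "has_bochner_integral (point_space p) (\<lambda>\<omega>. (real (N_G \<omega>))\<^sup>2)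
      ((\<Sum>n=4..6. (real n)\<^sup>2 * real ((n - 1) choose 3) * (p ^ 4 * q ^ (n - 4) + q ^ 4 * p ^ (n - 4)))
       + real (6 choose 3) * p ^ 3 * q ^ 3 * ((6 + 2 / s)\<^sup>2 + 4 * ((1 - s) / s\<^sup>2)))"
    unfolding eq2 by (intro has_bochner_integral_N_G[OF p]) simp_all
  then show ?square
    unfolding s_def[symmetric]
    by (simp only: distrib_left add.assoc mult.commute mult.left_commute)
qed

lemma mu_G_eq:
  fixes p q :: real
  assumes "0 \<le> p" and "p \<le> 1" and "q = 1 - p"
  shows "mu_G p =
           (\<Sum>n=4..6. real n * real ((n - 1) choose 3) * (p ^ 4 * q ^ (n - 4) + q ^ 4 * p ^ (n - 4)))
           + (6 + 2 / (p\<^sup>2 + q\<^sup>2)) * real (6 choose 3) * p ^ 3 * q ^ 3"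
  unfolding mu_G_def using N_G_moments(2)[OF assms] by (rule has_bochner_integral_integral_eq)

lemma sigma2_G_eq:
  fixes p q :: real
  assumes "0 \<le> p" and "p \<le> 1" and "q = 1 - p"
  shows "sigma2_G p =
           (((\<Sum>n=4..6. (real n)\<^sup>2 * real ((n - 1) choose 3) *
                (p ^ 4 * q ^ (n - 4) + q ^ 4 * p ^ (n - 4)))
             + (6 + 2 / (p\<^sup>2 + q\<^sup>2))\<^sup>2 * real (6 choose 3) * p ^ 3 * q ^ 3)
            - (mu_G p)\<^sup>2)
           + 4 * ((1 - (p\<^sup>2 + q\<^sup>2)) / (p\<^sup>2 + q\<^sup>2)\<^sup>2) * real (6 choose 3) * p ^ 3 * q ^ 3"
proof -
  interpret prob_space "point_space p" by (rule prob_space_point_space)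
  have "sigma2_G p = expectation (\<lambda>\<omega>. (real (N_G \<omega>))\<^sup>2) - (mu_G p)\<^sup>2"
    unfolding sigma2_G_def mu_G_def
    using N_G_moments(2,3)[OF assms, THEN integrable.intros] by (rule variance_eq)
  then show ?thesis
    by (simp only: N_G_moments(3)[OF assms, THEN has_bochner_integral_integral_eq])
qed

theorem theorem2p5:
  fixes p q :: real
  assumes "0 \<le> p" and "p \<le> 1" and "q = 1 - p"
  shows "(AE \<omega> in point_space p. \<exists>n. game_over \<omega> n) \<and>
    integrable (point_space p) (\<lambda>\<omega>. real (N_G \<omega>)) \<and>
    integrable (point_space p) (\<lambda>\<omega>. (real (N_G \<omega>))\<^sup>2) \<and>
    mu_G p =
           (\<Sum>n=4..6. real n * real ((n - 1) choose 3) * (p ^ 4 * q ^ (n - 4) + q ^ 4 * p ^ (n - 4)))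
           + (6 + 2 / (p\<^sup>2 + q\<^sup>2)) * real (6 choose 3) * p ^ 3 * q ^ 3 \<and>
    sigma2_G p =
           (((\<Sum>n=4..6. (real n)\<^sup>2 * real ((n - 1) choose 3) *
                (p ^ 4 * q ^ (n - 4) + q ^ 4 * p ^ (n - 4)))
             + (6 + 2 / (p\<^sup>2 + q\<^sup>2))\<^sup>2 * real (6 choose 3) * p ^ 3 * q ^ 3)
            - (mu_G p)\<^sup>2)
           + 4 * ((1 - (p\<^sup>2 + q\<^sup>2)) / (p\<^sup>2 + q\<^sup>2)\<^sup>2) * real (6 choose 3) * p ^ 3 * q ^ 3 \<and>
    mu_G p = mu_G q \<and>
    sigma2_G p = sigma2_G q"
proof (intro conjI)
  have q: "0 \<le> q" "q \<le> 1" "p = 1 - q"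
    using assms by simp_all
  note moments = N_G_moments[OF assms]
  show "AE \<omega> in point_space p. \<exists>n. game_over \<omega> n"
    by (fact moments(1))
  show "integrable (point_space p) (\<lambda>\<omega>. real (N_G \<omega>))"
    using moments(2) by (rule integrable.intros)
  show "integrable (point_space p) (\<lambda>\<omega>. (real (N_G \<omega>))\<^sup>2)"
    using moments(3) by (rule integrable.intros)
  show mu: "mu_G p = mu_G q"
    unfolding mu_G_eq[OF assms] mu_G_eq[OF q] by (simp only: ac_simps)
  show "sigma2_G p = sigma2_G q"
    unfolding sigma2_G_eq[OF assms] sigma2_G_eq[OF q] mu by (simp only: ac_simps)
qed (fact mu_G_eq[OF assms] sigma2_G_eq[OF assms])+

end
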